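(* Let $F$ be a field with $\operatorname{char}(F)\neq 2$ and let $A$ be a commutator-simple semiprime algebra over $F$ (associative, not necessarily unital). If a linear map $D\colon A\to A$ satisfies $D(x)x\in[A,A]$ and $D(x)x^2\in[A,A]$ for every $x\in A$, then $D$ is a derivation, i.e., $D(xy)=D(x)y+xD(y)$ for all $x,y\in A$.
   Context: Algebras are associative and not necessarily unital; ideals are two-sided. For an algebra $A$, $[x,y]=xy-yx$ and $[A,A]$ denotes the linear span of all commutators $[x,y]$ with $x,y\in A$. An algebra $A$ is commutator-simple if $[A,A]$ does not contain nonzero ideals of $A$. An algebra $A$ is semiprime if it has no nonzero nilpotent ideals. *)

theory Defs
  imports Main "HOL.Vector_Spaces"
begin

text \<open>Associative algebras over a field, not necessarily unital: the class \<open>ring\<close> has no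
  multiplicative identity.\<close>

locale assoc_algebra = vector_space scale
  for scale :: "'f::field \<Rightarrow> 'a::ring \<Rightarrow> 'a" (infixr \<open>*s\<close> 75) +
  assumes scale_mult_left: "c *s (x * y) = (c *s x) * y"
    and scale_mult_right: "c *s (x * y) = x * (c *s y)"
begin

definition commutator_span :: "'a set" where
  "commutator_span = span {x * y - y * x |x y. True}"

text \<open>Since there need not be an identity, closure under scalars does not follow from
  absorption and is required separately.\<close>

definition algebra_ideal :: "'a set \<Rightarrow> bool" where
  "algebra_ideal I \<longleftrightarrow> subspace I \<and> (\<forall>a. \<forall>x\<in>I. a * x \<in> I \<and> x * a \<in> I)"

definition ideal_mult :: "'a set \<Rightarrow> 'a set \<Rightarrow> 'a set" where
  "ideal_mult I J = span {x * y |x y. x \<in> I \<and> y \<in> J}"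

text \<open>The exponent is shifted by one, as \<open>I\<^sup>0\<close> makes no sense without an identity:
  \<open>ideal_power I n\<close> stands for the power of \<open>I\<close> with exponent \<open>n + 1\<close>.\<close>

primrec ideal_power :: "'a set \<Rightarrow> nat \<Rightarrow> 'a set" where
  "ideal_power I 0 = I"
| "ideal_power I (Suc n) = ideal_mult (ideal_power I n) I"

definition nilpotent_ideal :: "'a set \<Rightarrow> bool" where
  "nilpotent_ideal I \<longleftrightarrow> algebra_ideal I \<and> (\<exists>n. ideal_power I n = {0})"

definition commutator_simple :: bool where
  "commutator_simple \<longleftrightarrow> (\<forall>I. algebra_ideal I \<and> I \<subseteq> commutator_span \<longrightarrow> I = {0})"

definition semiprime :: bool where
  "semiprime \<longleftrightarrow> (\<forall>I. nilpotent_ideal I \<longrightarrow> I = {0})"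

end

end

theory Submission
  imports Defs
begin

text \<open>Calculate modulo \<open>[A,A]\<close> as with a trace. Linearising the two hypotheses gives
  \<open>D(x)y \<equiv> -D(y)x\<close> and \<open>D(x)(xy + yx) + D(y)x\<^sup>2 \<equiv> 0\<close>, hence
  \<open>(D(x)x + xD(x) - D(x\<^sup>2))y \<equiv> 0\<close> for all \<open>y\<close>. Commutator-simplicity and semiprimeness make
  this trace form nondegenerate, so \<open>D\<close> is a Jordan derivation. By Bresar's argument, a Jordan
  derivation of a 2-torsion-free semiprime ring is a derivation: its defect
  \<open>\<delta>(x,y) = D(xy) - D(x)y - xD(y)\<close> annihilates all commutators, so it is central, and then
  \<open>\<delta>(x,y)\<^sup>3 = 0\<close>.\<close>

section \<open>Jordan derivations and triple products\<close>

text \<open>Set over a bare ring: \<open>D\<close> is only additive, and semiprimeness takes its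
  elementwise form, so that each later vanishing claim p = 0 can be tested on the sandwich p z
  p.\<close>

locale semiprime_jordan_derivation =
  fixes D :: "'a::ring \<Rightarrow> 'a"
  assumes two_torsion_free: "x + x = 0 \<Longrightarrow> x = (0::'a)"
    and semiprime: "(\<And>z. x * z * x = 0) \<Longrightarrow> x = 0"
    and D_add: "D (x + y) = D x + D y"
    and D_square: "D (x * x) = D x * x + x * D x"
begin

lemma D_zero: "D 0 = 0"
  using D_add[of 0 0] by simp

lemma D_minus: "D (- x) = - D x"
  using D_add[of x "- x"] D_zero by (simp add: eq_neg_iff_add_eq_0 add.commute)

lemma D_diff: "D (x - y) = D x - D y"
  using D_add[of x "- y"] D_minus by simp

lemma D_jordan: "D (x * y + y * x) = D x * y + x * D y + D y * x + y * D x"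
  using D_square[of "x + y"] D_square[of x] D_square[of y] by (simp add: algebra_simps D_add)

text \<open>With the Jordan product p o q = pq + qp, one has 2xyx = x o (x o y) - x^2 o y, and
  \<open>D\<close> satisfies the Leibniz rule for o. Absence of 2-torsion removes the factor
  2.\<close>

lemma D_triple: "D (x * y * x) = D x * y * x + x * D y * x + x * y * D x"
proof -
  let ?p = "x * y + y * x"
  have "x * y * x + x * y * x = (x * ?p + ?p * x) - ((x * x) * y + y * (x * x))"
    by (simp add: algebra_simps)
  then have "D (x * y * x + x * y * x) = D (x * ?p + ?p * x) - D ((x * x) * y + y * (x * x))"
    by (simp only: D_diff)
  also have "\<dots> = (D x * y * x + x * D y * x + x * y * D x)
      + (D x * y * x + x * D y * x + x * y * D x)"
    unfolding D_jordan[of x ?p] D_jordan[of "x * x" y] unfolding D_jordan D_square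
    by (simp add: algebra_simps)
  finally show ?thesis
    using two_torsion_free[of "D (x * y * x) - (D x * y * x + x * D y * x + x * y * D x)"]
    by (simp add: D_add algebra_simps)
qed

lemma D_triple_linearized:
  "D (x * y * z + z * y * x) =
    D x * y * z + x * D y * z + x * y * D z + D z * y * x + z * D y * x + z * y * D x"
  using D_triple[of "x + z" y] D_triple[of x y] D_triple[of z y]
  by (simp add: algebra_simps D_add)

section \<open>The defect annihilates commutators\<close>

definition defect :: "'a \<Rightarrow> 'a \<Rightarrow> 'a" where
  "defect x y = D (x * y) - D x * y - x * D y"

lemma defect_add_left: "defect (x + u) y = defect x y + defect u y"
  by (simp add: defect_def D_add algebra_simps)

lemma defect_add_right: "defect x (y + v) = defect x y + defect x v"
  by (simp add: defect_def D_add algebra_simps)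

lemma D_mult: "D (x * y) = defect x y + D x * y + x * D y"
  by (simp add: defect_def)

lemma defect_swap: "defect y x = - defect x y"
  using D_jordan[of x y] by (simp add: D_add D_mult algebra_simps add_eq_0_iff)

text \<open>Both sides of the underlying identity are \<open>D(xywyx + yxwxy)\<close>.\<close>

lemma defect_commutator_anti:
  "defect x y * w * (x * y - y * x) + (x * y - y * x) * w * defect x y = 0"
proof -
  have "D (x * (y * w * y) * x + y * (x * w * x) * y) =
      D ((x * y) * w * (y * x) + (y * x) * w * (x * y))"
    by (simp add: algebra_simps)
  then have "D (x * (y * w * y) * x) + D (y * (x * w * x) * y) =
      D ((x * y) * w * (y * x) + (y * x) * w * (x * y))"
    by (simp only: D_add)
  then have "D x * (y * w * y) * x + x * D (y * w * y) * x + x * (y * w * y) * D x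
      + (D y * (x * w * x) * y + y * D (x * w * x) * y + y * (x * w * x) * D y) =
      D (x * y) * w * (y * x) + (x * y) * D w * (y * x) + (x * y) * w * D (y * x)
      + D (y * x) * w * (x * y) + (y * x) * D w * (x * y) + (y * x) * w * D (x * y)"
    by (simp only: D_triple[of x "y * w * y"] D_triple[of y "x * w * x"] D_triple_linearized)
  then show ?thesis
    unfolding D_triple[of x w] D_triple[of y w] D_mult[of x y] D_mult[of y x] defect_swap[of y x]
    by (simp add: algebra_simps)
qed

text \<open>The hypothesis allows \<open>a\<close> and \<open>b\<close> to be exchanged around any
  middle factor at the cost of a sign. Three exchanges turn p u p, with p = a w b, into its own
  negative.\<close>

lemma anticommuting_product_zero:
  fixes a b :: 'a
  assumes "\<And>w. a * w * b + b * w * a = 0"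
  shows "a * w * b = 0"
proof (rule semiprime)
  fix u
  have swap: "b * v * a = - (a * v * b)" for v
    using assms[of v] by (simp add: eq_neg_iff_add_eq_0 add.commute)
  have "a * w * b * u * (a * w * b) = a * w * (b * u * a) * (w * b)"
    by (simp add: mult.assoc)
  also have "\<dots> = - (a * (w * a * u) * b) * (w * b)"
    by (simp only: swap[of u]) (simp add: mult.assoc)
  also have "\<dots> = (b * (w * a * u) * a) * (w * b)"
    by (simp only: swap minus_minus)
  also have "\<dots> = (b * w * a) * u * a * w * b"
    by (simp only: mult.assoc)
  also have "\<dots> = - (a * w * b * u * (a * w * b))"
    by (simp only: swap[of w] mult_minus_left) (simp only: mult.assoc)
  finally show "a * w * b * u * (a * w * b) = 0"
    by (metis two_torsion_free eq_neg_iff_add_eq_0)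
qed

lemma defect_mult_own_commutator: "defect x y * w * (x * y - y * x) = 0"
  using anticommuting_product_zero defect_commutator_anti by blast

text \<open>Linearising \<open>defect_mult_own_commutator\<close> in x exchanges x and u up to sign.
  Rewriting only the second factor of p z p this way leaves \<open>defect x y\<close> at the left
  end and its own commutator at the right end.\<close>

lemma defect_mult_half_commutator: "defect x y * w * (u * y - y * u) = 0"
proof (rule semiprime)
  fix z
  have swap: "defect x y * w * (u * y - y * u) = - (defect u y * w * (x * y - y * x))"
    using defect_mult_own_commutator[of "x + u" y w] defect_mult_own_commutator[of x y w]
      defect_mult_own_commutator[of u y w]
    by (simp add: defect_add_left algebra_simps)
  have "defect x y * w * (u * y - y * u) * z * (defect x y * w * (u * y - y * u)) =
      - (defect x y * (w * (u * y - y * u) * z * defect u y * w) * (x * y - y * x))"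
    by (subst (2) swap) (simp only: mult.assoc minus_mult_right)
  then show "defect x y * w * (u * y - y * u) * z * (defect x y * w * (u * y - y * u)) = 0"
    by (simp only: defect_mult_own_commutator minus_zero)
qed

text \<open>The same device in the other variable: \<open>defect_mult_half_commutator\<close> is
  linearised in y.\<close>

lemma defect_mult_commutator: "defect x y * w * (u * v - v * u) = 0"
proof (rule semiprime)
  fix z
  have swap: "defect x y * w * (u * v - v * u) = - (defect x v * w * (u * y - y * u))"
    using defect_mult_half_commutator[of x "y + v" w u] defect_mult_half_commutator[of x y w u]
      defect_mult_half_commutator[of x v w u]
    by (simp add: defect_add_right algebra_simps)
  have "defect x y * w * (u * v - v * u) * z * (defect x y * w * (u * v - v * u)) =
      - (defect x y * (w * (u * v - v * u) * z * defect x v * w) * (u * y - y * u))"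
    by (subst (2) swap) (simp only: mult.assoc minus_mult_right)
  then show "defect x y * w * (u * v - v * u) * z * (defect x y * w * (u * v - v * u)) = 0"
    by (simp only: defect_mult_half_commutator minus_zero)
qed

text \<open>There is no unit to substitute for the middle factor w; the sandwich p z p supplies a
  middle factor instead.\<close>

lemma defect_commutator_zero: "defect x y * (u * v - v * u) = 0"
proof (rule semiprime)
  fix z
  show "defect x y * (u * v - v * u) * z * (defect x y * (u * v - v * u)) = 0"
    using defect_mult_commutator[of x y "(u * v - v * u) * z * defect x y" u v]
    by (simp only: mult.assoc)
qed

section \<open>Centrality and vanishing of the defect\<close>

lemma defect_central: "defect x y * u = u * defect x y"
proof -
  let ?c = "defect x y * u - u * defect x y"
  have "?c = 0"
  proof (rule semiprime)
    fix z
    \<comment> \<open>Since \<open>?c\<close> is itself a commutator, expanding only its first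
      occurrence makes each term contain a defect, a middle factor and a commutator.\<close>
    have "?c * z * ?c = defect x y * (u * z) * ?c - u * (defect x y * z * ?c)"
      by (simp only: left_diff_distrib mult.assoc)
    then show "?c * z * ?c = 0"
      by (simp only: defect_mult_commutator mult_zero_right diff_zero)
  qed
  then show ?thesis
    by simp
qed

lemma defect_zero: "defect x y = 0"
proof -
  define a where "a = defect x y"
  define b where "b = x * y - y * x"
  have central: "a * u = u * a" for u
    unfolding a_def by (rule defect_central)
  have annihilates: "a * (u * v - v * u) = 0" for u v
    unfolding a_def by (rule defect_commutator_zero)
  have ab: "a * b = 0" and ba: "b * a = 0"
    using annihilates[of x y] central[of b] by (simp_all add: b_def)
  \<comment> \<open>Up to commutators, which \<open>a\<close> annihilates, \<open>D b\<close> is 2a;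
    hence a D(b) = 2a^2.\<close>
  have "D b = a + a + (D x * y - y * D x) + (x * D y - D y * x)"
    by (simp add: b_def a_def D_diff D_mult defect_swap[of y x] algebra_simps)
  then have aDb: "a * D b = a * a + a * a"
    by (simp only: distrib_left annihilates add_0_right)
  \<comment> \<open>This is \<open>D\<close> applied to ab + ba = 0. Multiplying by the central
    element \<open>a\<close> kills the terms with \<open>b\<close> and leaves 4a^3 = 0.\<close>
  have "0 = D a * b + a * D b + D b * a + b * D a"
    using D_jordan[of a b] by (simp add: ab ba D_zero)
  then have "0 = a * (D a * b + a * D b + D b * a + b * D a)"
    by simp
  also have "\<dots> = D a * (a * b) + a * (a * D b) + a * (a * D b) + (a * b) * D a"
    by (simp add: distrib_left central[of "D a"] central[of "D b", symmetric]
        mult.assoc[symmetric])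
  also have "\<dots> = (a * a * a + a * a * a) + (a * a * a + a * a * a)"
    by (simp add: ab aDb distrib_left mult.assoc)
  finally have cube: "a * a * a = 0"
    using two_torsion_free by metis
  have square: "a * a = 0"
  proof (rule semiprime)
    fix z
    have "a * a * z * (a * a) = a * a * (z * a) * a"
      by (simp add: mult.assoc)
    also have "\<dots> = a * a * a * z * a"
      by (simp add: central[of z] mult.assoc)
    finally show "a * a * z * (a * a) = 0"
      by (simp add: cube)
  qed
  have "a = 0"
  proof (rule semiprime)
    show "a * z * a = 0" for z
      using square by (simp add: mult.assoc central[of z, symmetric]) (simp add: mult.assoc[symmetric])
  qed
  then show ?thesis
    by (simp add: a_def)
qed

theorem D_derivation: "D (x * y) = D x * y + x * D y"
  using defect_zero[of x y] by (simp add: D_mult)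

end

section \<open>Semiprimeness in elementwise form\<close>

context assoc_algebra
begin

lemma nilpotent_idealI:
  assumes "algebra_ideal I" and "\<And>x y z. x \<in> I \<Longrightarrow> y \<in> I \<Longrightarrow> z \<in> I \<Longrightarrow> x * y * z = 0"
  shows "nilpotent_ideal I"
proof -
  have zero: "w * z = 0" if "w \<in> ideal_mult I I" and "z \<in> I" for w z
    using that(1) unfolding ideal_mult_def
  proof (induction rule: span_induct)
    case base
    show ?case
      by (auto simp: subspace_def distrib_right scale_mult_left[symmetric])
  next
    case (step w)
    then show ?case
      using assms(2) that(2) by auto
  qed
  have "ideal_mult (ideal_mult I I) I \<subseteq> span {0}"
    unfolding ideal_mult_def[of "ideal_mult I I"] by (rule span_mono) (auto simp: zero)
  moreover have "0 \<in> ideal_mult (ideal_mult I I) I"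
    unfolding ideal_mult_def by (rule span_zero)
  \<comment> \<open>By the shifted exponent, this is the third power of \<open>I\<close>.\<close>
  ultimately have "ideal_power I 2 = {0}"
    by (auto simp: numeral_2_eq_2)
  then show ?thesis
    using assms(1) unfolding nilpotent_ideal_def by blast
qed

text \<open>The elements c with AcA = 0 form an ideal whose cube is zero. This replaces
  multiplication by a unit when passing from AaA = 0 to a = 0.\<close>

lemma semiprime_two_sided_annihilator:
  fixes a :: 'a
  assumes "semiprime" and "\<And>x y. x * a * y = 0"
  shows "a = 0"
proof -
  let ?N = "{c::'a. \<forall>x y. x * c * y = 0}"
  have "algebra_ideal ?N"
    unfolding algebra_ideal_def subspace_def
  proof (intro conjI allI ballI)
    fix b c assume "c \<in> ?N"
    then have c: "x * c * y = 0" for x y by blast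
    show "b * c \<in> ?N"
      using c by (simp add: mult.assoc[symmetric])
    show "c * b \<in> ?N"
      using c by (simp add: mult.assoc[symmetric])
  qed (auto simp: algebra_simps scale_mult_left[symmetric] scale_mult_right[symmetric])
  then have "nilpotent_ideal ?N"
    by (rule nilpotent_idealI) blast
  then show ?thesis
    using assms unfolding semiprime_def by blast
qed

text \<open>The ideal spanned by AaA squares to zero because aAa = 0, so it vanishes. As
  \<open>a\<close> itself need not lie in it, the preceding lemma finishes the proof.\<close>

lemma semiprime_elementwise:
  fixes a :: 'a
  assumes "semiprime" and a: "\<And>z. a * z * a = 0"
  shows "a = 0"
proof -
  let ?K = "span {x * a * y |x y. True}"
  have ideal: "b * c \<in> ?K \<and> c * b \<in> ?K" if "c \<in> ?K" for b c
    using that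
  proof (induction rule: span_induct)
    case base
    show ?case
      by (simp add: subspace_def distrib_right distrib_left scale_mult_left[symmetric]
          scale_mult_right[symmetric] span_add span_scale span_zero)
  next
    case (step c)
    then obtain x y where c: "c = x * a * y" by blast
    have "(b * x) * a * y \<in> ?K" "x * a * (y * b) \<in> ?K"
      by (auto intro!: span_base)
    then show ?case
      by (simp add: c mult.assoc)
  qed
  then have "algebra_ideal ?K"
    unfolding algebra_ideal_def using subspace_span by blast
  moreover have left: "a * c = 0" if "c \<in> ?K" for c
    using that
  proof (induction rule: span_induct)
    case base
    show ?case
      by (auto simp: subspace_def distrib_left scale_mult_right[symmetric])
  next
    case (step c)
    then show ?case
      using a by (auto simp: mult.assoc[symmetric])
  qed
  have product: "c * d = 0" if "c \<in> ?K" "d \<in> ?K" for c d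
    using that(1)
  proof (induction rule: span_induct)
    case base
    show ?case
      by (auto simp: subspace_def distrib_right scale_mult_left[symmetric])
  next
    case (step c)
    then obtain x y where c: "c = x * a * y" by blast
    have "a * (y * d) = 0"
      by (rule left[OF conjunct1[OF ideal[OF that(2)]]])
    then show ?case
      by (simp add: c mult.assoc)
  qed
  have "c * d * e = 0" if "c \<in> ?K" "d \<in> ?K" "e \<in> ?K" for c d e
    by (simp only: product[OF that(1,2)] mult_zero_left)
  ultimately have "nilpotent_ideal ?K"
    by (rule nilpotent_idealI)
  then have "?K = {0}"
    using assms(1) unfolding semiprime_def by blast
  moreover have "x * a * y \<in> ?K" for x y
    by (rule span_base) blast
  ultimately have "x * a * y = 0" for x y
    by (simp only: singleton_iff)
  then show ?thesis
    by (rule semiprime_two_sided_annihilator[OF assms(1)])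
qed

section \<open>The trace form modulo [A,A]\<close>

lemma commutator_in_span: "x * y - y * x \<in> commutator_span"
  unfolding commutator_span_def by (rule span_base) blast

lemma subspace_commutator_span: "subspace commutator_span"
  unfolding commutator_span_def by (rule subspace_span)

lemma commutator_span_swap: "x * y \<in> commutator_span \<Longrightarrow> y * x \<in> commutator_span"
  using subspace_add[OF subspace_commutator_span _ commutator_in_span[of y x], of "x * y"] by simp

text \<open>The radical \<open>?M\<close> of the form is stable under multiplication, but without a
  unit it need not lie in [A,A]. Its products with elements of A do, so the ideal \<open>?I\<close>
  contains Aa; commutator-simplicity gives Aa = 0.\<close>

lemma trace_form_nondegenerate:
  fixes a :: 'a
  assumes "commutator_simple" and "semiprime" and "\<And>x. a * x \<in> commutator_span"
  shows "a = 0"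
proof -
  let ?M = "{c. \<forall>x. c * x \<in> commutator_span}"
  let ?I = "?M \<inter> commutator_span"
  have M: "c * b \<in> ?I \<and> b * c \<in> ?I" if "c \<in> ?M" for b c
  proof -
    have c: "c * x \<in> commutator_span" for x
      using that by blast
    have "b * c * x \<in> commutator_span" for x
      using commutator_span_swap[of "c * x" b] c[of "x * b"] by (simp add: mult.assoc)
    then show ?thesis
      using c commutator_span_swap[OF c] by (auto simp: mult.assoc)
  qed
  have "subspace ?I"
    using subspace_commutator_span
    by (auto simp: subspace_def distrib_right scale_mult_left[symmetric])
  then have "algebra_ideal ?I"
    unfolding algebra_ideal_def using M by blast
  then have "?I = {0}"
    using assms(1) unfolding commutator_simple_def by blast
  then have "x * a = 0" for x
    using M assms(3) by blast
  then show ?thesis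
    using semiprime_two_sided_annihilator[OF assms(2)] by simp
qed

end

section \<open>From the trace conditions to a Jordan derivation\<close>

theorem theorem3p1:
  fixes scale :: "'f::field \<Rightarrow> 'a::ring \<Rightarrow> 'a"
    and D :: "'a \<Rightarrow> 'a"
  assumes "CHAR('f) \<noteq> 2"
    and "assoc_algebra scale"
    and "assoc_algebra.commutator_simple scale"
    and "assoc_algebra.semiprime scale"
    and "Vector_Spaces.linear scale scale D"
    and "\<And>x. D x * x \<in> assoc_algebra.commutator_span scale"
    and "\<And>x. D x * (x * x) \<in> assoc_algebra.commutator_span scale"
  shows "\<forall>x y. D (x * y) = D x * y + x * D y"
proof -
  interpret assoc_algebra scale
    by (fact assms(2))
  interpret D: Vector_Spaces.linear scale scale D
    by (fact assms(5))
  let ?C = commutator_span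
  note sub = subspace_commutator_span
  note add = subspace_add[OF sub] and diff = subspace_diff[OF sub]
  have "(2::'f) \<noteq> 0"
  proof
    assume "(2::'f) = 0"
    then have "of_nat 2 = (0::'f)"
      by simp
    then have "CHAR('f) dvd 2"
      by (simp only: of_nat_eq_0_iff_char_dvd)
    then have "CHAR('f) \<le> 2" "CHAR('f) \<noteq> 0"
      by (simp add: dvd_imp_le, intro notI, simp)
    moreover have "CHAR('f) \<noteq> 1"
      by simp
    ultimately show False
      using assms(1) by linarith
  qed
  have double: "x + x = scale 2 x" for x
    using scale_left_distrib[of 1 1 x] by simp
  have halve: "x \<in> ?C" if "x + x \<in> ?C" for x
    using subspace_scale[OF sub that, of "inverse 2"] \<open>2 \<noteq> 0\<close> by (simp add: double)
  have skew: "D x * y + D y * x \<in> ?C" for x y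
    using diff[OF diff[OF assms(6)[of "x + y"] assms(6)[of x]] assms(6)[of y]]
    by (simp add: D.add algebra_simps)
  have lin: "D x * (x * y + y * x) + D y * (x * x) \<in> ?C" (is "?p \<in> ?C") for x y
  proof (rule halve)
    \<comment> \<open>The difference keeps twice the part of odd degree in y; removing 2 D(y)y^2
      leaves twice the part linear in y. Only division by 2 is required, so characteristic 3 is
      covered.\<close>
    have "D (x + y) * ((x + y) * (x + y)) - D (x - y) * ((x - y) * (x - y))
        - D y * (y * y) - D y * (y * y) = ?p + ?p"
      by (simp add: D.add D.diff algebra_simps)
    then show "?p + ?p \<in> ?C"
      by (metis diff assms(7))
  qed
  have "semiprime_jordan_derivation D"
  proof
    show "x = 0" if "x + x = 0" for x :: 'a
      using that \<open>2 \<noteq> 0\<close> by (simp add: double)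
    show "x = 0" if "\<And>z. x * z * x = 0" for x :: 'a
      using semiprime_elementwise[OF assms(4)] that by blast
    show "D (x + y) = D x + D y" for x y
      by (rule D.add)
    show "D (x * x) = D x * x + x * D x" for x
    proof -
      have "(D x * x + x * D x - D (x * x)) * y \<in> ?C" for y
      proof -
        \<comment> \<open>The three groups are \<open>lin\<close>, a commutator that moves x
          cyclically to turn D(x)yx into xD(x)y, and \<open>skew\<close> for the pair x^2, y, which
          trades D(y)x^2 for -D(x^2)y.\<close>
        have "(D x * x + x * D x - D (x * x)) * y =
            (D x * (x * y + y * x) + D y * (x * x)) + (x * (D x * y) - (D x * y) * x)
              - (D (x * x) * y + D y * (x * x))"
          by (simp add: algebra_simps)
        then show ?thesis
          by (simp only: diff add lin commutator_in_span skew)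
      qed
      then have "D x * x + x * D x - D (x * x) = 0"
        by (rule trace_form_nondegenerate[OF assms(3,4)])
      then show ?thesis
        by simp
    qed
  qed
  then show ?thesis
    using semiprime_jordan_derivation.D_derivation by blast
qed

end
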